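(* Let $\mathcal H$ be a complex Hilbert space, let $k$ be a positive integer, and let $\mathbf A=(A_1,\dots,A_m)$ be an $m$-tuple of bounded self-adjoint operators on $\mathcal H$. If $\dim\mathcal H\ge((m+2)k-1)(m+1)^2$, then both $\Lambda_k(\mathbf A)$ and $\operatorname{cl}(\Lambda_k(\mathbf A))$ are star-shaped.
   Context: For an $m$-tuple $\mathbf A=(A_1,\dots,A_m)$ of bounded self-adjoint operators on a complex Hilbert space $\mathcal H$ and a positive integer $k$, the joint rank-$k$ numerical range is $\Lambda_k(\mathbf A)=\{(a_1,\dots,a_m)\in\mathbb R^m:$ there is an orthogonal projection $P$ of rank $k$ on $\mathcal H$ with $PA_jP=a_jP$ for $j=1,\dots,m\}$. $\operatorname{cl}$ denotes closure. A set $S\subseteq\mathbb R^m$ is star-shaped if there is $\mathbf c\in S$ such that for every $\mathbf b\in S$ the line segment joining $\mathbf c$ and $\mathbf b$ lies in $S$. *)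

theory Defs
  imports "HOL-Analysis.Analysis"
begin

text \<open>HOL-Analysis only provides real inner product spaces, so complex Hilbert
spaces are introduced here as a type class. The inner product is conjugate-linear
in the first and linear in the second argument.\<close>

class cvector = ab_group_add +
  fixes scaleC :: "complex \<Rightarrow> 'a \<Rightarrow> 'a" (infixr \<open>*\<^sub>C\<close> 75)
  assumes scaleC_add_right: "a *\<^sub>C (x + y) = a *\<^sub>C x + a *\<^sub>C y"
    and scaleC_add_left: "(a + b) *\<^sub>C x = a *\<^sub>C x + b *\<^sub>C x"
    and scaleC_scaleC: "a *\<^sub>C (b *\<^sub>C x) = (a * b) *\<^sub>C x"
    and scaleC_one: "1 *\<^sub>C x = x"

class cinner_space = cvector +
  fixes cinner :: "'a \<Rightarrow> 'a \<Rightarrow> complex"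
  assumes cinner_add_right: "cinner x (y + z) = cinner x y + cinner x z"
    and cinner_scaleC_right: "cinner x (a *\<^sub>C y) = a * cinner x y"
    and cinner_commute: "cinner y x = cnj (cinner x y)"
    and cinner_ge_zero: "0 \<le> Re (cinner x x)"
    and cinner_eq_zero_iff: "cinner x x = 0 \<longleftrightarrow> x = 0"

class chilbert_space = cinner_space +
  assumes complete:
    "(\<forall>e>0. \<exists>N::nat. \<forall>p\<ge>N. \<forall>q\<ge>N. sqrt (Re (cinner (X p - X q) (X p - X q))) < e)
      \<Longrightarrow> (\<exists>L. \<forall>e>0. \<exists>N::nat. \<forall>n\<ge>N. sqrt (Re (cinner (X n - L) (X n - L))) < e)"

definition cnorm :: "'a::cinner_space \<Rightarrow> real" where
  "cnorm x = sqrt (Re (cinner x x))"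

definition clinear_op :: "('a::cvector \<Rightarrow> 'a) \<Rightarrow> bool" where
  "clinear_op f \<longleftrightarrow> (\<forall>x y. f (x + y) = f x + f y) \<and> (\<forall>a x. f (a *\<^sub>C x) = a *\<^sub>C f x)"

definition bounded_op :: "('a::cinner_space \<Rightarrow> 'a) \<Rightarrow> bool" where
  "bounded_op f \<longleftrightarrow> clinear_op f \<and> (\<exists>C. \<forall>x. cnorm (f x) \<le> C * cnorm x)"

definition self_adjoint :: "('a::cinner_space \<Rightarrow> 'a) \<Rightarrow> bool" where
  "self_adjoint f \<longleftrightarrow> (\<forall>x y. cinner (f x) y = cinner x (f y))"

definition cindependent :: "'a::cvector set \<Rightarrow> bool" where
  "cindependent S \<longleftrightarrow> finite S \<and>
     (\<forall>c. (\<Sum>v\<in>S. c v *\<^sub>C v) = 0 \<longrightarrow> (\<forall>v\<in>S. c v = 0))"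

definition cspan_fin :: "'a::cvector set \<Rightarrow> 'a set" where
  "cspan_fin S = {(\<Sum>v\<in>S. c v *\<^sub>C v) | c. True}"

text \<open>Dimension of the space is at least n: there are n linearly independent vectors
(this also covers infinite-dimensional spaces).\<close>
definition dim_ge :: "'a::cvector itself \<Rightarrow> nat \<Rightarrow> bool" where
  "dim_ge _ n \<longleftrightarrow> (\<exists>S::'a set. cindependent S \<and> card S = n)"

definition subspace_dim :: "'a::cvector set \<Rightarrow> nat \<Rightarrow> bool" where
  "subspace_dim V k \<longleftrightarrow> (\<exists>S. S \<subseteq> V \<and> cindependent S \<and> card S = k \<and> V = cspan_fin S)"

definition orth_proj :: "('a::cinner_space \<Rightarrow> 'a) \<Rightarrow> bool" where
  "orth_proj P \<longleftrightarrow> bounded_op P \<and> P \<circ> P = P \<and> self_adjoint P"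

definition rank_k_proj :: "nat \<Rightarrow> ('a::cinner_space \<Rightarrow> 'a) \<Rightarrow> bool" where
  "rank_k_proj k P \<longleftrightarrow> orth_proj P \<and> subspace_dim (range P) k"

definition joint_rank_k_nr :: "nat \<Rightarrow> ('m::finite \<Rightarrow> 'a::cinner_space \<Rightarrow> 'a) \<Rightarrow> (real ^ 'm) set" where
  "joint_rank_k_nr k A = {a. \<exists>P. rank_k_proj k P \<and>
      (\<forall>j x. P (A j (P x)) = complex_of_real (a $ j) *\<^sub>C P x)}"

end

theory Submission
  imports Defs "Jordan_Normal_Form.Spectral_Radius"
begin

text \<open>Restrict to a finite-dimensional subspace and choose orthonormal vectors \<open>x i\<close> greedily so that
  \<open>\<langle>x i, A j (x l)\<rangle> = 0\<close> for \<open>i \<noteq> l\<close> and all \<open>j\<close>. With \<open>(K - 1)(m + 1) + 1\<close> of them, Tverberg's theorem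
  applied to the points \<open>(\<langle>x i, A j (x i)\<rangle>)\<^sub>j\<close> gives \<open>K\<close> disjoint convex combinations with a common
  value \<open>c\<close>; the combinations of the \<open>x i\<close> with the square roots of the weights then witness
  \<open>c \<in> \<Lambda>\<^sub>K\<close>. For \<open>K = (m + 2)k\<close> every such \<open>c\<close> is a star centre of \<open>\<Lambda>\<^sub>k\<close>: if \<open>y\<close> witnesses
  \<open>b \<in> \<Lambda>\<^sub>k\<close>, the \<open>(m + 1)k\<close> vectors \<open>y i\<close>, \<open>A j (y i)\<close> leave a \<open>k\<close>-dimensional part of the subspace
  for \<open>c\<close> that is orthogonal to all of them, and combining \<open>y\<close> with an orthonormal basis \<open>z\<close> of this
  part as \<open>\<surd>(1 - u) z i + \<surd>u y i\<close> realises \<open>(1 - u)c + ub\<close>.\<close>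

subsection \<open>Tverberg's theorem\<close>

text \<open>Each equation costs at most one unknown, so one unknown stays free. Over the reals this
  yields linear dependences among points, over the complex numbers vectors orthogonal to a given
  finite set.\<close>

lemma homogeneous_system_nontrivial_solution:
  fixes c :: "'i \<Rightarrow> 'l \<Rightarrow> 'f::field"
  assumes "finite L" "finite I" "card L < card I"
  shows "\<exists>\<beta>. (\<exists>i\<in>I. \<beta> i \<noteq> 0) \<and> (\<forall>l\<in>L. (\<Sum>i\<in>I. \<beta> i * c i l) = 0)"
  using assms
proof (induction L arbitrary: I c rule: finite_induct)
  case empty
  then obtain i where "i \<in> I" by (metis card.empty card_gt_0_iff equals0I)
  then show ?case by (intro exI[of _ "\<lambda>_. 1"]) auto
next
  case (insert l L)
  show ?case
  proof (cases "\<forall>i\<in>I. c i l = 0")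
    case True
    have "card L < card I" using insert by simp
    from insert.IH[OF \<open>finite I\<close> this, of c] True show ?thesis by auto
  next
    case False
    then obtain k where k: "k \<in> I" "c k l \<noteq> 0" by auto
    \<comment> \<open>Equation \<open>l\<close> determines the unknown \<open>k\<close> from the
      others; substituting it into the remaining equations leaves the coefficients
      \<open>d\<close>.\<close>
    define d where "d = (\<lambda>i l'. c i l' - c i l / c k l * c k l')"
    have "card L < card (I - {k})" using insert k by simp
    from insert.IH[OF _ this, of d] \<open>finite I\<close> obtain \<beta>
      where nz: "\<exists>i\<in>I - {k}. \<beta> i \<noteq> 0" and sol: "\<forall>l\<in>L. (\<Sum>i\<in>I - {k}. \<beta> i * d i l) = 0" by auto
    define b where "b = - (\<Sum>i\<in>I - {k}. \<beta> i * c i l) / c k l"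
    let ?\<beta> = "\<beta>(k := b)"
    have split: "(\<Sum>i\<in>I. ?\<beta> i * c i l') = b * c k l' + (\<Sum>i\<in>I - {k}. \<beta> i * c i l')" for l'
      using k(1) \<open>finite I\<close> by (subst sum.remove[of _ k]) (auto intro!: sum.cong)
    have "(\<Sum>i\<in>I. ?\<beta> i * c i l') = 0" if "l' \<in> insert l L" for l'
    proof (cases "l' = l")
      case True
      then show ?thesis unfolding split unfolding b_def using k by simp
    next
      case False
      then have "0 = (\<Sum>i\<in>I - {k}. \<beta> i * d i l')" using sol that by simp
      also have "\<dots> = (\<Sum>i\<in>I - {k}. \<beta> i * c i l') - (\<Sum>i\<in>I - {k}. \<beta> i * c i l) / c k l * c k l'"
        unfolding d_def by (simp add: sum_subtractf sum_divide_distrib sum_distrib_right sum_distrib_left algebra_simps)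
      finally show ?thesis unfolding split unfolding b_def by simp
    qed
    moreover have "\<exists>i\<in>I. ?\<beta> i \<noteq> 0" using nz by auto
    ultimately show ?thesis by blast
  qed
qed

section \<open>The colourful Caratheodory theorem\<close>

lemma nonneg_if_quadratic_nonneg:
  fixes a b :: real
  assumes "\<And>s. 0 < s \<Longrightarrow> s \<le> 1 \<Longrightarrow> 0 \<le> s * a + s\<^sup>2 * b"
  shows "0 \<le> a"
proof (rule ccontr)
  assume "\<not> 0 \<le> a"
  \<comment> \<open>With this \<open>s\<close> the term \<open>s * b\<close> is at most
    \<open>- a / 2\<close>, too small to outweigh the negative \<open>a\<close>.\<close>
  define s where "s = min 1 (- a / (2 * (\<bar>b\<bar> + 1)))"
  have s: "0 < s" "s \<le> 1" using \<open>\<not> 0 \<le> a\<close> by (auto simp: s_def field_simps)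
  have "s \<le> - a / (2 * (\<bar>b\<bar> + 1))" by (simp add: s_def)
  then have "s * (2 * (\<bar>b\<bar> + 1)) \<le> - a" by (simp add: field_simps)
  moreover have "s * b \<le> s * (\<bar>b\<bar> + 1)" using s by (intro mult_left_mono) auto
  ultimately have "a + s * b < 0" using \<open>\<not> 0 \<le> a\<close> by (simp add: algebra_simps)
  with s have "s * (a + s * b) < 0" by (simp add: mult_pos_neg)
  with assms[OF s] show False by (simp add: algebra_simps power2_eq_square)
qed

text \<open>Read \<open>i\<close> as a colour and the \<open>v i j\<close> as the points of that
  colour. For each choice of one point per colour the sum of squares is continuous in the weights,
  which range over a compact set, and there are only finitely many choices.\<close>

lemma colourful_caratheodory_minimiser:
  fixes v :: "'i \<Rightarrow> 'j \<Rightarrow> 'l \<Rightarrow> real"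
  assumes fin: "finite I" "finite J" and ne: "I \<noteq> {}" "J \<noteq> {}"
  obtains f \<alpha> where "f \<in> I \<rightarrow> J" "\<forall>i\<in>I. 0 \<le> \<alpha> i" "sum \<alpha> I = 1"
    "\<forall>g\<in>I \<rightarrow> J. \<forall>\<gamma>. (\<forall>i\<in>I. 0 \<le> \<gamma> i) \<longrightarrow> sum \<gamma> I = 1 \<longrightarrow>
      (\<Sum>l\<in>L. (\<Sum>i\<in>I. \<alpha> i * v i (f i) l)\<^sup>2) \<le> (\<Sum>l\<in>L. (\<Sum>i\<in>I. \<gamma> i * v i (g i) l)\<^sup>2)"
proof -
  \<comment> \<open>Weights are functions on the whole type, so the cube is compact by Tychonoff's
    theorem. Values outside \<open>I\<close> do not affect \<open>G\<close>, so minimality over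
    \<open>C\<close> carries over to all convex weights on \<open>I\<close>.\<close>
  define C :: "('i \<Rightarrow> real) set" where "C = PiE UNIV (\<lambda>_. {0..1}) \<inter> {\<alpha>. sum \<alpha> I = 1}"
  define G where "G = (\<lambda>f \<alpha>. \<Sum>l\<in>L. (\<Sum>i\<in>I. \<alpha> i * v i (f i) l)\<^sup>2)"
  have "compact (PiE UNIV (\<lambda>_::'i. {0..1::real}))"
    using compactin_PiE[of "\<lambda>_. euclidean :: real topology" UNIV "\<lambda>_::'i. {0..1}"]
    by (simp add: euclidean_product_topology)
  moreover have "closed {\<alpha>::'i \<Rightarrow> real. sum \<alpha> I = 1}"
    by (intro closed_Collect_eq continuous_on_sum continuous_on_product_coordinates continuous_on_const)
  ultimately have C: "compact C" unfolding C_def by (rule compact_Int_closed)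
  have trunc: "\<exists>\<gamma>'\<in>C. (\<forall>i\<in>I. \<gamma>' i = \<gamma> i)" if "\<forall>i\<in>I. 0 \<le> \<gamma> i" "sum \<gamma> I = 1" for \<gamma>
  proof -
    have "\<gamma> i \<le> 1" if "i \<in> I" for i
      using that member_le_sum[of i I \<gamma>] \<open>\<forall>i\<in>I. 0 \<le> \<gamma> i\<close> \<open>sum \<gamma> I = 1\<close> fin by auto
    then show ?thesis
      using that by (intro bexI[of _ "\<lambda>i. if i \<in> I then \<gamma> i else 0"]) (auto simp: C_def)
  qed
  have "compact (\<Union>f\<in>PiE I (\<lambda>_. J). G f ` C)"
    unfolding G_def using fin
    by (intro compact_UN compact_continuous_image C continuous_intros finite_PiE)
      (auto intro: continuous_on_subset[OF continuous_on_product_coordinates])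
  moreover have "(\<Union>f\<in>PiE I (\<lambda>_. J). G f ` C) \<noteq> {}"
  proof -
    have "(\<Sum>i\<in>I. 1 / real (card I)) = 1" using fin ne by simp
    from trunc[OF _ this] have "C \<noteq> {}" by auto
    then show ?thesis using ne by (auto simp: PiE_eq_empty_iff)
  qed
  ultimately obtain y where y: "y \<in> (\<Union>f\<in>PiE I (\<lambda>_. J). G f ` C)"
    and min: "\<forall>t\<in>(\<Union>f\<in>PiE I (\<lambda>_. J). G f ` C). y \<le> t"
    using compact_attains_inf[of "\<Union>f\<in>PiE I (\<lambda>_. J). G f ` C"] by metis
  obtain f \<alpha> where f: "f \<in> PiE I (\<lambda>_. J)" and \<alpha>: "\<alpha> \<in> C" and y_eq: "y = G f \<alpha>" using y by blast
  show thesis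
  proof
    show "f \<in> I \<rightarrow> J" using f by auto
    show "\<forall>i\<in>I. 0 \<le> \<alpha> i" "sum \<alpha> I = 1" using \<alpha> by (auto simp: C_def PiE_iff)
    have "G f \<alpha> \<le> G g \<gamma>" if g: "g \<in> I \<rightarrow> J" and \<gamma>: "\<forall>i\<in>I. 0 \<le> \<gamma> i" "sum \<gamma> I = 1" for g \<gamma>
    proof -
    obtain \<gamma>' where \<gamma>': "\<gamma>' \<in> C" "\<forall>i\<in>I. \<gamma>' i = \<gamma> i" using trunc[OF \<gamma>] by blast
    have "restrict g I \<in> PiE I (\<lambda>_. J)" using g by auto
    then have "y \<le> G (restrict g I) \<gamma>'" using \<gamma>' min by blast
    also have "G (restrict g I) \<gamma>' = G g \<gamma>" using \<gamma>' by (auto simp: G_def intro!: sum.cong)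
    finally show ?thesis unfolding y_eq .
    qed
    then show "\<forall>g\<in>I \<rightarrow> J. \<forall>\<gamma>. (\<forall>i\<in>I. 0 \<le> \<gamma> i) \<longrightarrow> sum \<gamma> I = 1 \<longrightarrow>
      (\<Sum>l\<in>L. (\<Sum>i\<in>I. \<alpha> i * v i (f i) l)\<^sup>2) \<le> (\<Sum>l\<in>L. (\<Sum>i\<in>I. \<gamma> i * v i (g i) l)\<^sup>2)"
      unfolding G_def by blast
  qed
qed

text \<open>Caratheodory's reduction: coefficients summing to zero, not all zero, include a positive
  one. Take \<open>t\<close> to be the least ratio \<open>\<alpha> i / \<beta> i\<close> over the
  positive \<open>\<beta> i\<close>; there the first coefficient reaches zero and none is yet
  negative.\<close>

lemma positive_combination_drop_index:
  fixes \<alpha> \<beta> :: "'i \<Rightarrow> real"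
  assumes "finite I" "\<forall>i\<in>I. 0 \<le> \<alpha> i" "sum \<beta> I = 0" "\<exists>i\<in>I. \<beta> i \<noteq> 0"
  obtains t where "\<forall>i\<in>I. 0 \<le> \<alpha> i - t * \<beta> i" "\<exists>i\<in>I. \<alpha> i - t * \<beta> i = 0"
proof -
  define P where "P = {i\<in>I. 0 < \<beta> i}"
  have "P \<noteq> {}"
  proof
    assume "P = {}"
    then have "\<forall>i\<in>I. \<beta> i \<le> 0" by (auto simp: P_def not_less)
    then have "\<forall>i\<in>I. \<beta> i = 0"
      using sum_nonneg_eq_0_iff[of I "\<lambda>i. - \<beta> i"] assms by (simp add: sum_negf)
    with assms(4) show False by auto
  qed
  moreover have "finite P" using assms by (simp add: P_def)
  ultimately obtain k where k: "k \<in> P" "\<And>i. i \<in> P \<Longrightarrow> \<alpha> k / \<beta> k \<le> \<alpha> i / \<beta> i"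
    using ex_min_if_finite[of "(\<lambda>i. \<alpha> i / \<beta> i) ` P"] by (force simp: not_less)
  show thesis
  proof
    show "\<exists>i\<in>I. \<alpha> i - \<alpha> k / \<beta> k * \<beta> i = 0" using k(1) by (auto simp: P_def intro!: bexI[of _ k])
    show "\<forall>i\<in>I. 0 \<le> \<alpha> i - \<alpha> k / \<beta> k * \<beta> i"
    proof
      fix i assume i: "i \<in> I"
      have "0 \<le> \<alpha> k / \<beta> k" using k(1) assms(2) by (auto simp: P_def)
      show "0 \<le> \<alpha> i - \<alpha> k / \<beta> k * \<beta> i"
      proof (cases "0 < \<beta> i")
        case True
        then have "\<alpha> k / \<beta> k \<le> \<alpha> i / \<beta> i" using k(2) i by (auto simp: P_def)
        then have "\<alpha> k / \<beta> k * \<beta> i \<le> \<alpha> i" using True by (subst (asm) pos_le_divide_eq) auto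
        then show ?thesis by simp
      next
        case False
        then have "\<alpha> k / \<beta> k * \<beta> i \<le> 0" using \<open>0 \<le> \<alpha> k / \<beta> k\<close> by (intro mult_nonneg_nonpos) auto
        moreover have "0 \<le> \<alpha> i" using assms(2) i by blast
        ultimately show ?thesis by linarith
      qed
    qed
  qed
qed

text \<open>Barany's argument: let \<open>p\<close> be nearest to the origin among all colourful
  convex combinations. If \<open>p\<close> were nonzero, the chosen points would lie on the
  hyperplane through \<open>p\<close> orthogonal to it. With more colours than coordinates some
  weight can be made zero without changing \<open>p\<close>, and the freed colour then has a point
  that brings the combination closer.\<close>

lemma colourful_caratheodory_balanced:
  fixes v :: "'i \<Rightarrow> 'j \<Rightarrow> 'l \<Rightarrow> real"
  assumes fin: "finite I" "finite J" "finite L" and card: "card L < card I" and J: "J \<noteq> {}"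
    and bal: "\<And>i l. i \<in> I \<Longrightarrow> l \<in> L \<Longrightarrow> (\<Sum>j\<in>J. v i j l) = 0"
  obtains f \<alpha> where "f \<in> I \<rightarrow> J" "\<forall>i\<in>I. 0 \<le> \<alpha> i" "sum \<alpha> I = 1"
    "\<forall>l\<in>L. (\<Sum>i\<in>I. \<alpha> i * v i (f i) l) = 0"
proof -
  have I: "I \<noteq> {}" using card by auto
  obtain f \<alpha> where f: "f \<in> I \<rightarrow> J" and \<alpha>: "\<forall>i\<in>I. 0 \<le> \<alpha> i" "sum \<alpha> I = 1"
    and min: "\<forall>g\<in>I \<rightarrow> J. \<forall>\<gamma>. (\<forall>i\<in>I. 0 \<le> \<gamma> i) \<longrightarrow> sum \<gamma> I = 1 \<longrightarrow>
      (\<Sum>l\<in>L. (\<Sum>i\<in>I. \<alpha> i * v i (f i) l)\<^sup>2) \<le> (\<Sum>l\<in>L. (\<Sum>i\<in>I. \<gamma> i * v i (g i) l)\<^sup>2)"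
    using colourful_caratheodory_minimiser[OF fin(1,2) I J, where v = v and L = L] .
  define p where "p = (\<lambda>l. \<Sum>i\<in>I. \<alpha> i * v i (f i) l)"
  define q where "q = (\<Sum>l\<in>L. (p l)\<^sup>2)"
  define ip where "ip = (\<lambda>w. \<Sum>l\<in>L. w l * p l)"
  \<comment> \<open>First-order optimality of \<open>p\<close>, stated for every colourful
    representation of \<open>p\<close> and not just for \<open>f\<close> and
    \<open>\<alpha>\<close>, because both the choice and the weights are changed below.\<close>
  have halfspace: "q \<le> ip (v k (g k))"
    if g: "g \<in> I \<rightarrow> J" and \<gamma>: "\<forall>i\<in>I. 0 \<le> \<gamma> i" "sum \<gamma> I = 1"
      and rep: "\<And>l. l \<in> L \<Longrightarrow> (\<Sum>i\<in>I. \<gamma> i * v i (g i) l) = p l" and k: "k \<in> I" for g \<gamma> k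
  proof -
    define w where "w = v k (g k)"
    have "0 \<le> s * (2 * (ip w - q)) + s\<^sup>2 * (\<Sum>l\<in>L. (w l - p l)\<^sup>2)" if s: "0 < s" "s \<le> 1" for s
    proof -
      \<comment> \<open>Moving weight \<open>s\<close> to colour \<open>k\<close> shifts the
        combination from \<open>p\<close> to \<open>p + s * (w - p)\<close>.\<close>
      define \<delta> where "\<delta> = (\<lambda>i. (1 - s) * \<gamma> i + (if i = k then s else 0))"
      have "\<forall>i\<in>I. 0 \<le> \<delta> i" using \<gamma> s by (auto simp: \<delta>_def)
      moreover have "sum \<delta> I = 1"
        using \<gamma> k fin by (simp add: \<delta>_def sum.distrib flip: sum_distrib_left)
      ultimately have "q \<le> (\<Sum>l\<in>L. (\<Sum>i\<in>I. \<delta> i * v i (g i) l)\<^sup>2)"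
        using min[rule_format, OF g, of \<delta>] by (simp add: q_def p_def)
      also have "(\<Sum>i\<in>I. \<delta> i * v i (g i) l) = p l + s * (w l - p l)" if "l \<in> L" for l
      proof -
        have "(\<Sum>i\<in>I. \<delta> i * v i (g i) l) = (1 - s) * (\<Sum>i\<in>I. \<gamma> i * v i (g i) l)
            + (\<Sum>i\<in>I. if i = k then s * v i (g i) l else 0)"
          unfolding \<delta>_def sum_distrib_left sum.distrib[symmetric]
          by (intro sum.cong) (auto simp: algebra_simps)
        then show ?thesis using rep[OF that] k fin by (simp add: w_def algebra_simps)
      qed
      then have "(\<Sum>l\<in>L. (\<Sum>i\<in>I. \<delta> i * v i (g i) l)\<^sup>2) = (\<Sum>l\<in>L. (p l + s * (w l - p l))\<^sup>2)" by simp
      also have "\<dots> = (\<Sum>l\<in>L. (p l)\<^sup>2 + s * (2 * (w l * p l - (p l)\<^sup>2)) + s\<^sup>2 * (w l - p l)\<^sup>2)"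
        by (intro sum.cong) (auto simp: algebra_simps power2_eq_square)
      also have "\<dots> = q + s * (2 * (ip w - q)) + s\<^sup>2 * (\<Sum>l\<in>L. (w l - p l)\<^sup>2)"
        unfolding q_def ip_def
        by (simp add: sum.distrib sum_subtractf right_diff_distrib flip: sum_distrib_left)
      finally show ?thesis by simp
    qed
    from nonneg_if_quadratic_nonneg[OF this] show ?thesis by (simp add: w_def)
  qed
  text \<open>If a colour \<open>k\<close> has weight zero, its point may be moved to all of its \<open>J\<close> positions, which
    average to zero and so cannot all lie beyond the hyperplane through \<open>p\<close>.\<close>
  have no_free: "q = 0"
    if \<gamma>: "\<forall>i\<in>I. 0 \<le> \<gamma> i" "sum \<gamma> I = 1"
      and rep: "\<And>l. l \<in> L \<Longrightarrow> (\<Sum>i\<in>I. \<gamma> i * v i (f i) l) = p l" and k: "k \<in> I" "\<gamma> k = 0" for \<gamma> k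
  proof -
    have "q \<le> ip (v k j)" if j: "j \<in> J" for j
    proof -
      have "(\<Sum>i\<in>I. \<gamma> i * v i ((f(k := j)) i) l) = p l" if "l \<in> L" for l
        unfolding rep[OF that, symmetric] using k by (intro sum.cong) auto
      from halfspace[OF _ \<gamma> this k(1)] f j show ?thesis by (auto simp: Pi_iff)
    qed
    then have "(\<Sum>j\<in>J. q) \<le> (\<Sum>j\<in>J. ip (v k j))" by (rule sum_mono)
    also have "\<dots> = (\<Sum>l\<in>L. (\<Sum>j\<in>J. v k j l) * p l)"
      unfolding ip_def sum_distrib_right by (rule sum.swap)
    also have "\<dots> = 0" using bal k by simp
    finally have "real (card J) * q \<le> 0" by simp
    moreover have "card J > 0" using J fin by (simp add: card_gt_0_iff)
    ultimately have "q \<le> 0" by (simp add: mult_le_0_iff)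
    moreover have "0 \<le> q" by (simp add: q_def sum_nonneg)
    ultimately show ?thesis by simp
  qed
  have "q = 0"
  proof (rule ccontr)
    assume q: "q \<noteq> 0"
    have pos: "0 < \<alpha> i" if "i \<in> I" for i
      using no_free[OF \<alpha> _ that] q \<alpha> that by (force simp: p_def)
    have ge: "q \<le> ip (v i (f i))" if "i \<in> I" for i
      using halfspace[OF f \<alpha> _ that] by (simp add: p_def)
    have ip_sum: "(\<Sum>i\<in>I. \<beta> i * ip (v i (f i))) = (\<Sum>l\<in>L. (\<Sum>i\<in>I. \<beta> i * v i (f i) l) * p l)" for \<beta>
      unfolding ip_def sum_distrib_left sum_distrib_right by (subst sum.swap) (simp add: mult.assoc)
    \<comment> \<open>An average of values that are all at least \<open>q\<close> equals
      \<open>q\<close>; as the weights are positive, every value is \<open>q\<close>.\<close>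
    have "(\<Sum>i\<in>I. \<alpha> i * ip (v i (f i))) = q"
      unfolding ip_sum q_def by (simp add: p_def power2_eq_square)
    then have "(\<Sum>i\<in>I. \<alpha> i * (ip (v i (f i)) - q)) = 0"
      using \<alpha>(2) by (simp add: right_diff_distrib sum_subtractf flip: sum_distrib_right)
    then have "\<forall>i\<in>I. \<alpha> i * (ip (v i (f i)) - q) = 0"
      using sum_nonneg_eq_0_iff[of I "\<lambda>i. \<alpha> i * (ip (v i (f i)) - q)"] fin ge \<alpha> by simp
    then have on_plane: "ip (v i (f i)) = q" if "i \<in> I" for i using pos that by fastforce
    obtain \<beta> where nz: "\<exists>i\<in>I. \<beta> i \<noteq> 0" and sol: "\<forall>l\<in>L. (\<Sum>i\<in>I. \<beta> i * v i (f i) l) = 0"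
      using homogeneous_system_nontrivial_solution[OF fin(3,1) card] by metis
    \<comment> \<open>Since all chosen points satisfy \<open>ip = q\<close> with
      \<open>q \<noteq> 0\<close>, a linear dependence among them is automatically an affine
      one.\<close>
    have "q * sum \<beta> I = (\<Sum>i\<in>I. \<beta> i * ip (v i (f i)))"
      using on_plane by (simp add: sum_distrib_left mult.commute)
    also have "\<dots> = 0" using sol by (simp add: ip_sum)
    finally have \<beta>0: "sum \<beta> I = 0" using q by simp
    obtain t where t: "\<forall>i\<in>I. 0 \<le> \<alpha> i - t * \<beta> i" "\<exists>i\<in>I. \<alpha> i - t * \<beta> i = 0"
      using positive_combination_drop_index[OF fin(1) \<alpha>(1) \<beta>0 nz] .
    have "(\<Sum>i\<in>I. (\<alpha> i - t * \<beta> i) * v i (f i) l) = p l" if "l \<in> L" for l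
    proof -
      have "(\<Sum>i\<in>I. (\<alpha> i - t * \<beta> i) * v i (f i) l) = p l - t * (\<Sum>i\<in>I. \<beta> i * v i (f i) l)"
        unfolding p_def sum_distrib_left sum_subtractf[symmetric]
        by (intro sum.cong) (auto simp: algebra_simps)
      then show ?thesis using sol that by simp
    qed
    moreover have "(\<Sum>i\<in>I. \<alpha> i - t * \<beta> i) = 1"
      using \<alpha>(2) \<beta>0 by (simp add: sum_subtractf flip: sum_distrib_left)
    ultimately show False using no_free[of "\<lambda>i. \<alpha> i - t * \<beta> i"] t q by blast
  qed
  then have "\<forall>l\<in>L. p l = 0" using fin(3) by (simp add: q_def sum_nonneg_eq_0_iff)
  with f \<alpha> show thesis by (intro that) (auto simp: p_def)
qed

text \<open>Sarkaria's argument: \<open>w\<close> lists \<open>K\<close> vectors in dimension \<open>K - 1\<close> whose only linear dependence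
  is that they sum to zero, and the coordinates of the lifted points tensored with them are indexed
  by \<open>L\<close>; the coordinate \<open>None\<close> of a lifted point is \<open>1\<close>.\<close>
lemma tverberg:
  fixes a :: "'i \<Rightarrow> 'm::finite \<Rightarrow> real"
  assumes I: "finite I" "card I = (K - 1) * (CARD('m) + 1) + 1" and K: "K > 0"
  obtains f \<alpha> c where "f \<in> I \<rightarrow> {..<K}" "\<forall>i\<in>I. 0 \<le> \<alpha> i"
    "\<And>j. j < K \<Longrightarrow> (\<Sum>i | i \<in> I \<and> f i = j. \<alpha> i) = 1"
    "\<And>j r. j < K \<Longrightarrow> (\<Sum>i | i \<in> I \<and> f i = j. \<alpha> i * a i r) = c r"
proof -
  define b where "b = (\<lambda>i r. case r of None \<Rightarrow> 1 | Some r \<Rightarrow> a i r)"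
  define w :: "nat \<Rightarrow> nat \<Rightarrow> real"
    where "w = (\<lambda>j l. (if j = l then 1 else 0) - (if j = K - 1 then 1 else 0))"
  define L where "L = (UNIV :: 'm option set) \<times> {..<K - 1}"
  have cardL: "card L < card I" using I by (simp add: L_def card_UNIV_option mult.commute)
  have finL: "finite L" by (simp add: L_def)
  have bal: "(\<Sum>j\<in>{..<K}. case l of (r, l') \<Rightarrow> b i r * w j l') = 0" if "l \<in> L" for i l
    using that K by (auto simp: L_def w_def sum_subtractf simp flip: sum_distrib_left)
  have ne: "{..<K} \<noteq> {}" using K by auto
  obtain f \<alpha> where f: "f \<in> I \<rightarrow> {..<K}" and \<alpha>: "\<forall>i\<in>I. 0 \<le> \<alpha> i" "sum \<alpha> I = 1"
    and zero: "\<forall>l\<in>L. (\<Sum>i\<in>I. \<alpha> i * (case l of (r, l') \<Rightarrow> b i r * w (f i) l')) = 0"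
    using colourful_caratheodory_balanced[where v = "\<lambda>i j l. case l of (r, l') \<Rightarrow> b i r * w j l'",
      OF I(1) finite_lessThan finL cardL ne bal] by blast
  define T where "T = (\<lambda>j r. \<Sum>i | i \<in> I \<and> f i = j. \<alpha> i * b i r)"
  \<comment> \<open>\<open>T j\<close> is the weighted sum of the lifted points in part
    \<open>j\<close>. Coordinate \<open>(r, j)\<close> of the relation compares part
    \<open>j\<close> with the last part \<open>K - 1\<close>.\<close>
  have T_eq: "T j r = T (K - 1) r" if "j < K" for j r
  proof (cases "j = K - 1")
    case False
    then have "(r, j) \<in> L" using that by (auto simp: L_def)
    then have "0 = (\<Sum>i\<in>I. \<alpha> i * (b i r * w (f i) j))" using zero by auto
    also have "\<dots> = (\<Sum>i\<in>I. (if f i = j then \<alpha> i * b i r else 0)) - (\<Sum>i\<in>I. (if f i = K - 1 then \<alpha> i * b i r else 0))"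
      unfolding sum_subtractf[symmetric] by (intro sum.cong) (auto simp: w_def)
    also have "\<dots> = T j r - T (K - 1) r"
      unfolding T_def by (simp only: sum.inter_filter[OF I(1), symmetric])
    finally show ?thesis by simp
  qed simp
  \<comment> \<open>In coordinate \<open>None\<close> the equality says that the parts share the
    total weight 1 equally, hence the factor \<open>real K\<close> in the final weights.\<close>
  have "(\<Sum>j<K. T j None) = sum \<alpha> I"
    unfolding T_def b_def using sum.group[of I "{..<K}" f \<alpha>] f I by (simp add: Pi_iff image_subset_iff)
  moreover have "(\<Sum>j<K. T j None) = (\<Sum>j<K. T (K - 1) None)"
    by (intro sum.cong refl T_eq) simp
  ultimately have one: "real K * T (K - 1) None = 1" using \<alpha> by simp
  show thesis
  proof
    show "f \<in> I \<rightarrow> {..<K}" by fact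
    show "\<forall>i\<in>I. 0 \<le> real K * \<alpha> i" using \<alpha> by simp
    show "(\<Sum>i | i \<in> I \<and> f i = j. real K * \<alpha> i) = 1" if "j < K" for j
      using T_eq[OF that, of None] one by (simp add: T_def b_def flip: sum_distrib_left)
    show "(\<Sum>i | i \<in> I \<and> f i = j. real K * \<alpha> i * a i r) = real K * T (K - 1) (Some r)" if "j < K" for j r
      using T_eq[OF that, of "Some r"] by (simp add: T_def b_def mult.assoc flip: sum_distrib_left)
  qed
qed

subsection \<open>Complex inner product spaces\<close>

interpretation cvec: vector_space "scaleC :: complex \<Rightarrow> 'a \<Rightarrow> 'a::cvector"
  by unfold_locales (simp_all add: scaleC_add_right scaleC_add_left scaleC_scaleC scaleC_one)

lemma cspan_fin_eq_span: "finite S \<Longrightarrow> cspan_fin S = cvec.span S"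
  by (auto simp: cspan_fin_def cvec.span_finite)

lemma clinear_op_zero: "clinear_op f \<Longrightarrow> f 0 = 0"
  unfolding clinear_op_def by (metis cvec.scale_zero_left)

lemma clinear_op_sum: "clinear_op f \<Longrightarrow> f (\<Sum>i\<in>I. c i *\<^sub>C x i) = (\<Sum>i\<in>I. c i *\<^sub>C f (x i))"
  by (induction I rule: infinite_finite_induct) (auto simp: clinear_op_zero, auto simp: clinear_op_def)

lemma clinear_op_ident: "clinear_op (\<lambda>x. x)"
  by (simp add: clinear_op_def)

lemma cinner_add_left: "cinner (x + y) z = cinner x z + cinner y z"
  by (metis cinner_add_right cinner_commute complex_cnj_add)

lemma cinner_scaleC_left: "cinner (a *\<^sub>C x) y = cnj a * cinner x y"
  by (metis cinner_scaleC_right cinner_commute complex_cnj_mult)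

lemma cinner_zero_right: "cinner x 0 = 0"
  using cinner_scaleC_right[of x 0 0] by simp

lemma cinner_zero_left: "cinner 0 x = 0"
  using cinner_scaleC_left[of 0 0 x] by simp

lemma cinner_sum_right: "cinner x (\<Sum>i\<in>I. c i *\<^sub>C y i) = (\<Sum>i\<in>I. c i * cinner x (y i))"
  by (induction I rule: infinite_finite_induct)
    (auto simp: cinner_zero_right cinner_add_right cinner_scaleC_right)

lemma cinner_sum_left: "cinner (\<Sum>i\<in>I. c i *\<^sub>C x i) y = (\<Sum>i\<in>I. cnj (c i) * cinner (x i) y)"
  by (induction I rule: infinite_finite_induct)
    (auto simp: cinner_zero_left cinner_add_left cinner_scaleC_left)

lemmas cinner_simps = cinner_add_left cinner_add_right cinner_scaleC_left cinner_scaleC_right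

lemma cinner_eq_zero_commute: "cinner x y = 0 \<longleftrightarrow> cinner y x = 0"
  by (metis cinner_commute complex_cnj_zero)

lemma cinner_self: "cinner x x = of_real (Re (cinner x x))"
  by (metis cinner_commute Reals_cnj_iff of_real_Re)

lemma self_adjoint_cinner_real:
  assumes "self_adjoint f"
  shows "cinner x (f x) = of_real (Re (cinner x (f x)))"
proof -
  have "cnj (cinner x (f x)) = cinner x (f x)"
    using assms cinner_commute[of "f x" x] by (simp add: self_adjoint_def)
  then show ?thesis by (simp add: complex_eq_iff)
qed

text \<open>Indexing by an initial segment of the naturals allows a vector to be appended by
  function update and two families to be combined index by index.\<close>

definition orthonormal :: "nat \<Rightarrow> (nat \<Rightarrow> 'a::cinner_space) \<Rightarrow> bool" where
  "orthonormal n e \<longleftrightarrow> (\<forall>i<n. \<forall>j<n. cinner (e i) (e j) = (if i = j then 1 else 0))"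

lemma orthonormal_mono: "orthonormal n e \<Longrightarrow> k \<le> n \<Longrightarrow> orthonormal k e"
  by (auto simp: orthonormal_def)

lemma orthonormal_inj_on:
  assumes "orthonormal n e"
  shows "inj_on e {..<n}"
proof (rule inj_onI)
  fix i j assume "i \<in> {..<n}" "j \<in> {..<n}" "e i = e j"
  then show "i = j" using assms unfolding orthonormal_def
    by (metis lessThan_iff zero_neq_one)
qed

lemma orthonormal_cindependent:
  assumes "orthonormal n e"
  shows "cindependent (e ` {..<n})" "card (e ` {..<n}) = n"
proof -
  have inj: "inj_on e {..<n}" by (rule orthonormal_inj_on[OF assms])
  show "card (e ` {..<n}) = n" using inj by (simp add: card_image)
  have "c (e l) = 0" if zero: "(\<Sum>v\<in>e ` {..<n}. c v *\<^sub>C v) = 0" and l: "l < n" for c l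
  proof -
    have "0 = cinner (e l) (\<Sum>i<n. c (e i) *\<^sub>C e i)"
      using zero by (simp add: sum.reindex[OF inj] cinner_zero_right)
    also have "\<dots> = (\<Sum>i<n. if i = l then c (e i) else 0)"
      unfolding cinner_sum_right using assms l by (intro sum.cong) (auto simp: orthonormal_def)
    also have "\<dots> = c (e l)" using l by simp
    finally show ?thesis by simp
  qed
  then show "cindependent (e ` {..<n})" by (auto simp: cindependent_def)
qed

lemma normalise_vector:
  assumes "x \<noteq> 0"
  obtains r :: real where "cinner (of_real r *\<^sub>C x) (of_real r *\<^sub>C x) = 1"
proof
  define r where "r = sqrt (Re (cinner x x))"
  have "Re (cinner x x) \<noteq> 0" using assms cinner_self[of x] cinner_eq_zero_iff[of x] by auto
  then have "r \<noteq> 0" "cinner x x = of_real (r * r)"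
    using cinner_ge_zero[of x] cinner_self[of x] by (auto simp: r_def)
  then show "cinner (of_real (1 / r) *\<^sub>C x) (of_real (1 / r) *\<^sub>C x) = 1"
    by (simp add: cinner_simps)
qed

text \<open>Orthogonality to \<open>F\<close> is a homogeneous system for the coefficients over
  \<open>S\<close> with fewer equations than unknowns; independence of \<open>S\<close> makes the
  resulting vector nonzero.\<close>

lemma unit_vector_orthogonal_to_few:
  fixes S F :: "'a::cinner_space set"
  assumes S: "cindependent S" and F: "finite F" "card F < card S"
  obtains x where "x \<in> cspan_fin S" "cinner x x = 1" "\<forall>y\<in>F. cinner y x = 0"
proof -
  have fin: "finite S" using S by (simp add: cindependent_def)
  obtain \<beta> where nz: "\<exists>s\<in>S. \<beta> s \<noteq> 0" and sol: "\<forall>y\<in>F. (\<Sum>s\<in>S. \<beta> s * cinner y s) = 0"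
    using homogeneous_system_nontrivial_solution[OF F(1) fin F(2), of "\<lambda>s y. cinner y s"] by blast
  define x where "x = (\<Sum>s\<in>S. \<beta> s *\<^sub>C s)"
  have "x \<noteq> 0" using S nz unfolding x_def cindependent_def by blast
  then obtain r :: real where r: "cinner (of_real r *\<^sub>C x) (of_real r *\<^sub>C x) = 1"
    by (rule normalise_vector)
  show thesis
  proof
    have "x \<in> cspan_fin S" by (auto simp: x_def cspan_fin_def)
    then show "of_real r *\<^sub>C x \<in> cspan_fin S"
      by (simp add: cspan_fin_eq_span[OF fin] cvec.span_scale)
    show "cinner (of_real r *\<^sub>C x) (of_real r *\<^sub>C x) = 1"
      by (rule r)
    show "\<forall>y\<in>F. cinner y (of_real r *\<^sub>C x) = 0"
      using sol by (simp add: cinner_simps x_def cinner_sum_right)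
  qed
qed

lemma orthonormal_Suc:
  assumes "orthonormal n e" "cinner x x = 1" "\<forall>i<n. cinner (e i) x = 0"
  shows "orthonormal (Suc n) (e(n := x))"
proof -
  have "\<forall>i<n. cinner x (e i) = 0" using assms(3) cinner_eq_zero_commute by blast
  with assms show ?thesis by (auto simp: orthonormal_def less_Suc_eq)
qed

text \<open>Greedy choice: each new vector is taken orthogonal to \<open>F\<close> and to its
  predecessors. With \<open>F\<close> empty this replaces Gram-Schmidt.\<close>

lemma orthonormal_orthogonal_to_few:
  fixes S F :: "'a::cinner_space set"
  assumes S: "cindependent S" and F: "finite F" "card F + n \<le> card S"
  shows "\<exists>e. orthonormal n e \<and> (\<forall>i<n. e i \<in> cspan_fin S \<and> (\<forall>y\<in>F. cinner y (e i) = 0))"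
  using F(2)
proof (induction n)
  case 0
  then show ?case by (simp add: orthonormal_def)
next
  case (Suc n)
  then obtain e where e: "orthonormal n e"
    "\<forall>i<n. e i \<in> cspan_fin S \<and> (\<forall>y\<in>F. cinner y (e i) = 0)" by auto
  have "card (F \<union> e ` {..<n}) \<le> card F + card {..<n}"
    by (intro order_trans[OF card_Un_le] add_left_mono card_image_le) simp
  then have "card (F \<union> e ` {..<n}) < card S" using Suc.prems by simp
  then obtain x where x: "x \<in> cspan_fin S" "cinner x x = 1" "\<forall>y\<in>F \<union> e ` {..<n}. cinner y x = 0"
    using unit_vector_orthogonal_to_few[OF S, of "F \<union> e ` {..<n}"] F(1) by blast
  have "orthonormal (Suc n) (e(n := x))" using e x by (intro orthonormal_Suc) auto
  then show ?case by (rule exI[where x = "e(n := x)", OF conjI]) (use e x in \<open>auto simp: less_Suc_eq\<close>)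
qed

subsection \<open>Joint higher rank numerical ranges\<close>

lemma rank_k_proj_orthonormal:
  assumes e: "orthonormal k e"
  shows "rank_k_proj k (\<lambda>x. \<Sum>i<k. cinner (e i) x *\<^sub>C e i)" (is "rank_k_proj k ?P")
proof -
  have e_sum: "cinner (e l) (\<Sum>i<k. c i *\<^sub>C e i) = c l" if "l < k" for c l
  proof -
    have "cinner (e l) (\<Sum>i<k. c i *\<^sub>C e i) = (\<Sum>i<k. if i = l then c i else 0)"
      unfolding cinner_sum_right using e that by (intro sum.cong) (auto simp: orthonormal_def)
    then show ?thesis using that by simp
  qed
  have lin: "clinear_op ?P"
    by (simp add: clinear_op_def cinner_simps cvec.scale_left_distrib sum.distrib cvec.scale_sum_right)
  have idem: "?P (?P x) = ?P x" for x
    using e_sum by (intro sum.cong) auto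
  have sa: "cinner (?P x) y = cinner x (?P y)" for x y
    unfolding cinner_sum_left cinner_sum_right
    by (intro sum.cong refl) (metis cinner_commute mult.commute)
  have "cnorm (?P x) \<le> 1 * cnorm x" for x
  proof -
    \<comment> \<open>Bessel's inequality: the squared norm of \<open>x - ?P x\<close> is the
      difference of those of \<open>x\<close> and \<open>?P x\<close>.\<close>
    let ?y = "x + (-1) *\<^sub>C ?P x"
    have "cinner x (?P x) = cinner (?P x) (?P x)" using sa[of x "?P x"] idem by simp
    moreover have "cinner (?P x) x = cinner (?P x) (?P x)" using sa[of "?P x" x] idem sa by metis
    ultimately have "cinner ?y ?y = cinner x x - cinner (?P x) (?P x)"
      by (simp only: cinner_simps) simp
    then show ?thesis using cinner_ge_zero[of ?y] by (simp add: cnorm_def)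
  qed
  then have "bounded_op ?P" using lin unfolding bounded_op_def by blast
  then have proj: "orth_proj ?P"
    using idem sa by (auto simp: orth_proj_def self_adjoint_def fun_eq_iff)
  have inj: "inj_on e {..<k}" by (rule orthonormal_inj_on[OF e])
  have "range ?P = cspan_fin (e ` {..<k})"
  proof
    have "e i \<in> cspan_fin (e ` {..<k})" if "i < k" for i
      using that by (simp add: cspan_fin_eq_span cvec.span_base)
    then show "range ?P \<subseteq> cspan_fin (e ` {..<k})"
      by (auto simp: cspan_fin_eq_span intro!: cvec.span_sum cvec.span_scale)
    show "cspan_fin (e ` {..<k}) \<subseteq> range ?P"
    proof
      fix x assume "x \<in> cspan_fin (e ` {..<k})"
      then obtain c where x: "x = (\<Sum>i<k. c (e i) *\<^sub>C e i)"
        by (auto simp: cspan_fin_def sum.reindex[OF inj])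
      have "?P x = x" unfolding x using e_sum by (intro sum.cong) auto
      then show "x \<in> range ?P" by (rule range_eqI[OF sym])
    qed
  qed
  moreover have "e ` {..<k} \<subseteq> cspan_fin (e ` {..<k})"
    unfolding cspan_fin_eq_span[OF finite_imageI[OF finite_lessThan]] by (rule cvec.span_superset)
  ultimately have "subspace_dim (range ?P) k"
    unfolding subspace_dim_def using orthonormal_cindependent[OF e]
    by (intro exI[of _ "e ` {..<k}"]) simp
  with proj show ?thesis by (simp add: rank_k_proj_def)
qed

text \<open>An orthonormal basis of the range of \<open>P\<close> turns the operator equation into
  one on matrix entries, so that later constructions need only supply vectors.\<close>

lemma mem_joint_rank_k_nr_iff:
  fixes A :: "'m::finite \<Rightarrow> 'h::cinner_space \<Rightarrow> 'h" and a :: "real ^ 'm"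
  assumes lin: "\<And>j. clinear_op (A j)"
  shows "a \<in> joint_rank_k_nr k A \<longleftrightarrow> (\<exists>e. orthonormal k e \<and>
    (\<forall>j. \<forall>i<k. \<forall>l<k. cinner (e i) (A j (e l)) = (if i = l then of_real (vec_nth a j) else 0)))"
    (is "?L \<longleftrightarrow> ?R")
proof
  assume ?L
  then obtain P where P: "orth_proj P" "subspace_dim (range P) k"
    and PA: "\<And>j x. P (A j (P x)) = of_real (vec_nth a j) *\<^sub>C P x"
    by (auto simp: joint_rank_k_nr_def rank_k_proj_def)
  obtain S where S: "cindependent S" "card S = k" "range P = cspan_fin S"
    using P(2) by (auto simp: subspace_dim_def)
  obtain e where e: "orthonormal k e" "\<forall>i<k. e i \<in> range P"
    using orthonormal_orthogonal_to_few[OF S(1), of "{}" k] S by auto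
  have fix_P: "P (e i) = e i" if "i < k" for i
  proof -
    have "e i \<in> range P" using e(2) that by blast
    then obtain x where "e i = P x" by (rule rangeE)
    then show ?thesis using P(1) by (metis comp_apply orth_proj_def)
  qed
  have "cinner (e i) (A j (e l)) = (if i = l then of_real (vec_nth a j) else 0)" if "i < k" "l < k" for i j l
  proof -
    have "cinner (e i) (A j (e l)) = cinner (P (e i)) (A j (P (e l)))" using fix_P that by simp
    also have "\<dots> = cinner (e i) (P (A j (P (e l))))"
      using P(1) by (simp add: orth_proj_def self_adjoint_def)
    also have "P (A j (P (e l))) = of_real (vec_nth a j) *\<^sub>C e l"
      using PA[of j "e l"] fix_P[OF that(2)] by simp
    also have "cinner (e i) (of_real (vec_nth a j) *\<^sub>C e l) = of_real (vec_nth a j) * cinner (e i) (e l)"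
      by (rule cinner_scaleC_right)
    finally show ?thesis using e(1) that by (simp add: orthonormal_def)
  qed
  with e(1) show ?R by blast
next
  assume ?R
  then obtain e where e: "orthonormal k e"
    and A: "\<And>j i l. i < k \<Longrightarrow> l < k \<Longrightarrow> cinner (e i) (A j (e l)) = (if i = l then of_real (vec_nth a j) else 0)"
    by blast
  define P where "P = (\<lambda>x. \<Sum>i<k. cinner (e i) x *\<^sub>C e i)"
  have "P (A j (P x)) = of_real (vec_nth a j) *\<^sub>C P x" for j x
  proof -
    have "cinner (e i) (A j (P x)) = of_real (vec_nth a j) * cinner (e i) x" if "i < k" for i
    proof -
      have "cinner (e i) (A j (P x)) = (\<Sum>l<k. cinner (e l) x * cinner (e i) (A j (e l)))"
        unfolding P_def clinear_op_sum[OF lin] cinner_sum_right ..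
      also have "\<dots> = (\<Sum>l<k. if l = i then of_real (vec_nth a j) * cinner (e l) x else 0)"
        using A that by (intro sum.cong) auto
      finally show ?thesis using that by simp
    qed
    then show ?thesis
      unfolding P_def[of] cvec.scale_sum_right by (intro sum.cong) (auto simp: P_def)
  qed
  then show ?L using rank_k_proj_orthonormal[OF e] by (auto simp: joint_rank_k_nr_def P_def)
qed

text \<open>\<open>T\<close> need not map the span into itself. The vector comes from an eigenvector
  of the matrix of the compression of \<open>T\<close>, so the eigenvalue equation holds when tested
  against vectors of the span.\<close>

lemma compression_eigenvector:
  fixes T :: "'h::cinner_space \<Rightarrow> 'h"
  assumes e: "orthonormal n e" and n: "n > 0" and T: "clinear_op T"
  obtains x c where "x \<in> cspan_fin (e ` {..<n})" "cinner x x = 1"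
    "\<And>y. y \<in> cspan_fin (e ` {..<n}) \<Longrightarrow> cinner y (T x) = c * cinner y x"
proof -
  define M where "M = mat n n (\<lambda>(i, l). cinner (e i) (T (e l)))"
  have M: "M \<in> carrier_mat n n" by (simp add: M_def)
  obtain c u where "eigenvector M u c"
    using spectrum_non_empty[OF M n] by (auto simp: spectrum_def eigenvalue_def)
  then have u: "u \<in> carrier_vec n" "u \<noteq> 0\<^sub>v n" and Mu: "M *\<^sub>v u = c \<cdot>\<^sub>v u"
    using M by (auto simp: eigenvector_def)
  define x where "x = (\<Sum>l<n. vec_index u l *\<^sub>C e l)"
  let ?S = "cspan_fin (e ` {..<n})"
  have xS: "x \<in> ?S"
    unfolding x_def by (auto simp: cspan_fin_eq_span intro!: cvec.span_sum cvec.span_scale intro: cvec.span_base)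
  have ex: "cinner (e i) x = vec_index u i" if "i < n" for i
  proof -
    have "cinner (e i) x = (\<Sum>l<n. if l = i then vec_index u l else 0)"
      unfolding x_def cinner_sum_right using e that by (intro sum.cong) (auto simp: orthonormal_def)
    then show ?thesis using that by simp
  qed
  have eTx: "cinner (e i) (T x) = c * cinner (e i) x" if "i < n" for i
  proof -
    have "cinner (e i) (T x) = (\<Sum>l<n. vec_index u l * cinner (e i) (T (e l)))"
      unfolding x_def clinear_op_sum[OF T] cinner_sum_right ..
    also have "\<dots> = vec_index (M *\<^sub>v u) i"
      using that u(1) by (simp add: M_def scalar_prod_def mult.commute atLeast0LessThan)
    finally show ?thesis using Mu that u(1) by (simp add: ex)
  qed
  have span: "cinner y (T x) = c * cinner y x" if "y \<in> ?S" for y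
  proof -
    have "y \<in> cvec.span (e ` {..<n})" using that by (simp add: cspan_fin_eq_span)
    then show ?thesis
      by (induction rule: cvec.span_induct_alt)
        (auto simp: cinner_zero_left cinner_simps eTx algebra_simps)
  qed
  have "x \<noteq> 0"
  proof
    assume "x = 0"
    then have "u = 0\<^sub>v n" using u(1) ex by (intro eq_vecI) (auto simp: cinner_zero_right)
    with u(2) show False by simp
  qed
  then obtain r :: real where r: "cinner (of_real r *\<^sub>C x) (of_real r *\<^sub>C x) = 1"
    by (rule normalise_vector)
  show thesis
  proof
    show "of_real r *\<^sub>C x \<in> ?S" using xS by (simp add: cspan_fin_eq_span cvec.span_scale)
    show "cinner (of_real r *\<^sub>C x) (of_real r *\<^sub>C x) = 1"
      by (rule r)
    show "cinner y (T (of_real r *\<^sub>C x)) = c * cinner y (of_real r *\<^sub>C x)" if "y \<in> ?S" for y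
      using span[OF that] T by (simp add: clinear_op_def cinner_simps)
  qed
qed

text \<open>Starting from an eigenvector of the compression of one of the \<open>A j\<close> saves one orthogonality
  condition in every step; without this the dimension bound would be off by one.\<close>
lemma orthonormal_joint_diagonal:
  fixes A :: "'m::finite \<Rightarrow> 'h::cinner_space \<Rightarrow> 'h" and e :: "nat \<Rightarrow> 'h"
  assumes lin: "\<And>j. clinear_op (A j)" and sa: "\<And>j. self_adjoint (A j)"
    and e: "orthonormal n e" and n: "n > 0" "t * (CARD('m) + 1) \<le> n"
  shows "\<exists>x. orthonormal (Suc t) x \<and>
    (\<forall>j. \<forall>i\<le>t. \<forall>l\<le>t. i \<noteq> l \<longrightarrow> cinner (x i) (A j (x l)) = 0)"
proof -
  let ?B = "e ` {..<n}"
  fix j0 :: 'm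
  obtain x0 c where x0: "x0 \<in> cspan_fin ?B" "cinner x0 x0 = 1"
    and eig: "\<And>y. y \<in> cspan_fin ?B \<Longrightarrow> cinner y (A j0 x0) = c * cinner y x0"
    using compression_eigenvector[OF e n(1) lin[of j0]] by blast
  \<comment> \<open>Keeping \<open>x 0 = x0\<close> in the induction makes the eigenvector property
    available at every step.\<close>
  have "\<exists>x. x 0 = x0 \<and> orthonormal (Suc t) x \<and>
    (\<forall>j. \<forall>i\<le>t. \<forall>l\<le>t. i \<noteq> l \<longrightarrow> cinner (x i) (A j (x l)) = 0)" using n(2)
  proof (induction t)
    case 0
    then show ?case using x0 by (intro exI[of _ "\<lambda>_. x0"]) (auto simp: orthonormal_def)
  next
    case (Suc t)
    then obtain x where x: "x 0 = x0" "orthonormal (Suc t) x"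
      and diag: "\<And>j i l. i \<le> t \<Longrightarrow> l \<le> t \<Longrightarrow> i \<noteq> l \<Longrightarrow> cinner (x i) (A j (x l)) = 0" by auto
    \<comment> \<open>The omitted pair stands for orthogonality to \<open>A j0 x0\<close>, which
      \<open>eig\<close> gives to any vector of the span orthogonal to \<open>x0\<close>. This
      leaves strictly fewer than \<open>Suc t * (CARD('m) + 1)\<close> conditions.\<close>
    define D where "D = (UNIV :: 'm set) \<times> {..t} - {(j0, 0)}"
    define F where "F = x ` {..t} \<union> (\<lambda>(j, i). A j (x i)) ` D"
    have finD: "finite D" by (simp add: D_def)
    have "card D = CARD('m) * Suc t - 1"
      unfolding D_def by (subst card_Diff_singleton) (auto simp: card_cartesian_product)
    have "card F \<le> card {..t} + card D"
      unfolding F_def by (intro order_trans[OF card_Un_le] add_mono card_image_le finD) simp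
    also have "\<dots> < Suc t * (CARD('m) + 1)"
    proof -
      have "CARD('m) * Suc t > 0" by simp
      then have "CARD('m) * Suc t - 1 < CARD('m) * Suc t" by simp
      then show ?thesis using \<open>card D = _\<close> by (simp add: algebra_simps)
    qed
    also have "\<dots> \<le> card ?B" using Suc.prems orthonormal_cindependent[OF e] by simp
    finally obtain y where y: "y \<in> cspan_fin ?B" "cinner y y = 1" and yF: "\<forall>z\<in>F. cinner z y = 0"
      using unit_vector_orthogonal_to_few[OF orthonormal_cindependent(1)[OF e], of F] finD
      by (auto simp: F_def)
    have xy: "cinner (x i) y = 0" if "i \<le> t" for i using yF that by (auto simp: F_def)
    have Axy: "cinner (A j (x i)) y = 0" if "i \<le> t" for i j
    proof (cases "(j, i) = (j0, 0)")
      case True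
      have "cinner y (A j0 x0) = c * cinner y (x 0)" using eig[OF y(1)] x(1) by simp
      also have "\<dots> = 0" using xy[of 0] cinner_eq_zero_commute[of y] by simp
      finally show ?thesis using True x(1) cinner_eq_zero_commute[of y] by simp
    next
      case False
      then have "(j, i) \<in> D" using that by (auto simp: D_def)
      then show ?thesis using yF by (force simp: F_def)
    qed
    \<comment> \<open>Self-adjointness makes one condition kill both off-diagonal entries.\<close>
    have Ayx: "cinner (x i) (A j y) = 0" "cinner y (A j (x i)) = 0" if "i \<le> t" for i j
      using Axy[OF that, of j] sa[of j] cinner_eq_zero_commute[of y] by (simp_all add: self_adjoint_def)
    show ?case
    proof (intro exI[of _ "x(Suc t := y)"] conjI allI impI)
      show "(x(Suc t := y)) 0 = x0" using x by simp
      show "orthonormal (Suc (Suc t)) (x(Suc t := y))"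
        using x y xy by (intro orthonormal_Suc) auto
      show "cinner ((x(Suc t := y)) i) (A j ((x(Suc t := y)) l)) = 0"
        if "i \<le> Suc t" "l \<le> Suc t" "i \<noteq> l" for j i l
        using that diag[of i l j] Ayx by (auto simp: le_Suc_eq)
    qed
  qed
  then show ?thesis by blast
qed

section \<open>From jointly diagonal vectors to a point of the rank-\<open>K\<close> range\<close>

lemma cinner_diagonal_sums:
  assumes T: "clinear_op T" and fin: "finite P" "finite Q"
    and diag: "\<And>i l. i \<in> P \<Longrightarrow> l \<in> Q \<Longrightarrow> cinner (x i) (T (x l)) = (if i = l then of_real (d i) else 0)"
  shows "cinner (\<Sum>i\<in>P. of_real (\<beta> i) *\<^sub>C x i) (T (\<Sum>l\<in>Q. of_real (\<beta> l) *\<^sub>C x l))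
    = of_real (\<Sum>i\<in>P \<inter> Q. (\<beta> i)\<^sup>2 * d i)"
proof -
  have "cinner (\<Sum>i\<in>P. of_real (\<beta> i) *\<^sub>C x i) (T (\<Sum>l\<in>Q. of_real (\<beta> l) *\<^sub>C x l))
    = (\<Sum>i\<in>P. of_real (\<beta> i) * (\<Sum>l\<in>Q. of_real (\<beta> l) * cinner (x i) (T (x l))))"
    unfolding clinear_op_sum[OF T] unfolding cinner_sum_left unfolding cinner_sum_right by simp
  also have "\<dots> = (\<Sum>i\<in>P. of_real (\<beta> i) * (\<Sum>l\<in>Q. if l = i then of_real (\<beta> i * d i) else 0))"
    using diag by (intro sum.cong arg_cong2[where f = "(*)"] refl) auto
  also have "\<dots> = (\<Sum>i\<in>P. if i \<in> Q then of_real ((\<beta> i)\<^sup>2 * d i) else 0)"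
    using fin by (intro sum.cong) (auto simp: power2_eq_square)
  also have "\<dots> = of_real (\<Sum>i\<in>P \<inter> Q. (\<beta> i)\<^sup>2 * d i)"
    using fin unfolding of_real_sum by (subst sum.inter_restrict) auto
  finally show ?thesis .
qed

lemma joint_rank_k_nr_nonempty:
  fixes A :: "'m::finite \<Rightarrow> 'h::cinner_space \<Rightarrow> 'h"
  assumes lin: "\<And>j. clinear_op (A j)" and sa: "\<And>j. self_adjoint (A j)"
    and K: "K > 1" and dim: "dim_ge TYPE('h) ((K - 1) * (CARD('m) + 1)^2)"
  shows "joint_rank_k_nr K A \<noteq> {}"
proof -
  define n where "n = (K - 1) * (CARD('m) + 1)^2"
  \<comment> \<open>Tverberg's theorem needs \<open>t + 1\<close> points for \<open>K\<close> parts,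
    and \<open>t * (CARD('m) + 1)\<close> dimensions suffice to build that many vectors.\<close>
  define t where "t = (K - 1) * (CARD('m) + 1)"
  have n: "n > 0" "t * (CARD('m) + 1) \<le> n"
    using K by (simp_all add: n_def t_def power2_eq_square algebra_simps)
  obtain S :: "'h set" where S: "cindependent S" "card S = n" using dim by (auto simp: dim_ge_def n_def)
  obtain e :: "nat \<Rightarrow> 'h" where e: "orthonormal n e"
    using orthonormal_orthogonal_to_few[OF S(1), of "{}" n] S(2) by auto
  obtain x where x: "orthonormal (Suc t) x"
    and diag: "\<And>j i l. i \<le> t \<Longrightarrow> l \<le> t \<Longrightarrow> i \<noteq> l \<Longrightarrow> cinner (x i) (A j (x l)) = 0"
    using orthonormal_joint_diagonal[of A, OF lin sa e n] by blast
  define a where "a = (\<lambda>i j. Re (cinner (x i) (A j (x i))))"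
  have A_x: "cinner (x i) (A j (x l)) = (if i = l then of_real (a i j) else 0)" if "i \<le> t" "l \<le> t" for i j l
    using diag[OF that] self_adjoint_cinner_real[OF sa] by (auto simp: a_def)
  have K0: "K > 0" using K by simp
  have "card {..t} = (K - 1) * (CARD('m) + 1) + 1" by (simp add: t_def)
  from tverberg[OF finite_atMost this K0, of a] obtain f \<alpha> c where f: "f \<in> {..t} \<rightarrow> {..<K}"
    and \<alpha>: "\<forall>i\<in>{..t}. 0 \<le> \<alpha> i"
    and one: "\<And>j. j < K \<Longrightarrow> (\<Sum>i | i \<in> {..t} \<and> f i = j. \<alpha> i) = 1"
    and bary: "\<And>j r. j < K \<Longrightarrow> (\<Sum>i | i \<in> {..t} \<and> f i = j. \<alpha> i * a i r) = c r" by blast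
  define I where "I = (\<lambda>j. {i. i \<in> {..t} \<and> f i = j})"
  have fin: "finite (I j)" for j by (simp add: I_def)
  define z where "z = (\<lambda>j. \<Sum>i\<in>I j. of_real (sqrt (\<alpha> i)) *\<^sub>C x i)"
  \<comment> \<open>Square roots become the Tverberg weights in the quadratic form. Taking
    \<open>T\<close> as the identity gives orthonormality, taking \<open>T\<close> as
    \<open>A j\<close> gives the common barycentre on the diagonal.\<close>
  have z: "cinner (z p) (T (z q)) = (if p = q then of_real (\<Sum>i\<in>I p. \<alpha> i * d i) else 0)"
    if T: "clinear_op T" and d: "\<And>i l. i \<le> t \<Longrightarrow> l \<le> t \<Longrightarrow> cinner (x i) (T (x l)) = (if i = l then of_real (d i) else 0)"
    for T d p q
  proof -
    have "cinner (z p) (T (z q)) = of_real (\<Sum>i\<in>I p \<inter> I q. (sqrt (\<alpha> i))\<^sup>2 * d i)"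
      unfolding z_def using d by (intro cinner_diagonal_sums[OF T fin fin]) (auto simp: I_def)
    also have "(\<Sum>i\<in>I p \<inter> I q. (sqrt (\<alpha> i))\<^sup>2 * d i) = (\<Sum>i\<in>I p \<inter> I q. \<alpha> i * d i)"
      using \<alpha> by (intro sum.cong) (auto simp: I_def)
    moreover have "p \<noteq> q \<Longrightarrow> I p \<inter> I q = {}" by (auto simp: I_def)
    ultimately show ?thesis by auto
  qed
  have "orthonormal K z"
    using z[OF clinear_op_ident, of "\<lambda>_. 1"] x one by (simp add: orthonormal_def I_def)
  moreover have "cinner (z p) (A j (z q)) = (if p = q then of_real (vec_nth (vec_lambda c) j) else 0)"
    if "p < K" "q < K" for p q j
    using z[OF lin, of j "\<lambda>i. a i j" p q] A_x bary[OF that(1), of j] by (auto simp: I_def simp del: of_real_sum)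
  ultimately have "vec_lambda c \<in> joint_rank_k_nr K A"
    unfolding mem_joint_rank_k_nr_iff[of A, OF lin] by blast
  then show ?thesis by blast
qed

section \<open>Star centres\<close>

lemma joint_rank_k_nr_antimono:
  fixes A :: "'m::finite \<Rightarrow> 'h::cinner_space \<Rightarrow> 'h"
  assumes "\<And>j. clinear_op (A j)" "k \<le> K" "a \<in> joint_rank_k_nr K A"
  shows "a \<in> joint_rank_k_nr k A"
proof -
  obtain e where "orthonormal K e"
    "\<forall>j. \<forall>i<K. \<forall>l<K. cinner (e i) (A j (e l)) = (if i = l then of_real (vec_nth a j) else 0)"
    using assms(3) unfolding mem_joint_rank_k_nr_iff[of A, OF assms(1)] by blast
  then show ?thesis
    unfolding mem_joint_rank_k_nr_iff[of A, OF assms(1)]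
    using orthonormal_mono assms(2) by (intro exI[of _ e]) auto
qed

lemma joint_rank_k_nr_segment:
  fixes A :: "'m::finite \<Rightarrow> 'h::cinner_space \<Rightarrow> 'h"
  assumes lin: "\<And>j. clinear_op (A j)" and sa: "\<And>j. self_adjoint (A j)"
    and c: "c \<in> joint_rank_k_nr ((CARD('m) + 2) * k) A" and b: "b \<in> joint_rank_k_nr k A"
    and u: "0 \<le> u" "u \<le> 1"
  shows "(1 - u) *\<^sub>R c + u *\<^sub>R b \<in> joint_rank_k_nr k A"
proof -
  define K where "K = (CARD('m) + 2) * k"
  obtain e where e: "orthonormal K e"
    and Ae: "\<And>j i l. i < K \<Longrightarrow> l < K \<Longrightarrow> cinner (e i) (A j (e l)) = (if i = l then of_real (vec_nth c j) else 0)"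
    using c unfolding mem_joint_rank_k_nr_iff[of A, OF lin] K_def by blast
  obtain y where y: "orthonormal k y"
    and Ay: "\<And>j i l. i < k \<Longrightarrow> l < k \<Longrightarrow> cinner (y i) (A j (y l)) = (if i = l then of_real (vec_nth b j) else 0)"
    using b unfolding mem_joint_rank_k_nr_iff[of A, OF lin] by blast
  let ?B = "e ` {..<K}"
  \<comment> \<open>At most \<open>(CARD('m) + 1) * k\<close> vectors are to be avoided, which
    leaves room for \<open>k\<close> orthonormal ones in dimension
    \<open>(CARD('m) + 2) * k\<close>.\<close>
  define F where "F = y ` {..<k} \<union> (\<lambda>(j, i). A j (y i)) ` ((UNIV :: 'm set) \<times> {..<k})"
  have "card F \<le> card {..<k} + card ((UNIV :: 'm set) \<times> {..<k})"
    unfolding F_def by (intro order_trans[OF card_Un_le] add_mono card_image_le) auto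
  then have "card F + k \<le> card ?B"
    using orthonormal_cindependent(2)[OF e] by (simp add: K_def card_cartesian_product algebra_simps)
  then obtain z where z: "orthonormal k z" "\<And>i. i < k \<Longrightarrow> z i \<in> cspan_fin ?B"
    and zF: "\<And>i v. i < k \<Longrightarrow> v \<in> F \<Longrightarrow> cinner v (z i) = 0"
    using orthonormal_orthogonal_to_few[OF orthonormal_cindependent(1)[OF e], of F k]
    by (auto simp: F_def)
  \<comment> \<open>On the span of \<open>e\<close> every \<open>A j\<close> compresses to a scalar,
    so any orthonormal family in it, in particular \<open>z\<close>, again realises
    \<open>c\<close>.\<close>
  have scalar: "cinner v (A j w) = of_real (vec_nth c j) * cinner v w"
    if v: "v \<in> cspan_fin ?B" and w: "w \<in> cspan_fin ?B" for v w j
  proof -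
    have basis: "cinner (e i) (A j w) = of_real (vec_nth c j) * cinner (e i) w" if i: "i < K" for i
    proof -
      have "w \<in> cvec.span ?B" using w by (simp add: cspan_fin_eq_span)
      then show ?thesis
      proof (induction rule: cvec.span_induct_alt)
        case base
        then show ?case by (simp add: clinear_op_zero[OF lin] cinner_zero_right)
      next
        case (step a v w)
        then obtain l where "l < K" "v = e l" by auto
        then have "cinner (e i) (A j v) = of_real (vec_nth c j) * cinner (e i) v"
          using Ae i e by (simp add: orthonormal_def)
        with step lin[of j] show ?case by (simp add: clinear_op_def cinner_simps algebra_simps)
      qed
    qed
    have "v \<in> cvec.span ?B" using v by (simp add: cspan_fin_eq_span)
    then show ?thesis
      by (induction rule: cvec.span_induct_alt)
        (auto simp: cinner_zero_left cinner_simps basis algebra_simps)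
  qed
  have Az: "cinner (z i) (A j (z l)) = (if i = l then of_real (vec_nth c j) else 0)" if "i < k" "l < k" for i j l
    using scalar z that by (simp add: orthonormal_def)
  have yz: "cinner (y i) (z l) = 0" "cinner (z l) (y i) = 0" if "i < k" "l < k" for i l
    using zF[of l "y i"] that cinner_eq_zero_commute by (auto simp: F_def)
  have Ayz: "cinner (y i) (A j (z l)) = 0" "cinner (z l) (A j (y i)) = 0" if "i < k" "l < k" for i l j
  proof -
    have "A j (y i) \<in> F" using that by (force simp: F_def)
    then have "cinner (A j (y i)) (z l) = 0" using zF that by blast
    then show "cinner (z l) (A j (y i)) = 0" by (simp add: cinner_eq_zero_commute)
    show "cinner (y i) (A j (z l)) = 0"
      using \<open>cinner (A j (y i)) (z l) = 0\<close> sa[of j] by (simp add: self_adjoint_def)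
  qed
  \<comment> \<open>The cross terms between \<open>z\<close> and \<open>y\<close> vanish, for the
    inner product and for every \<open>A j\<close>, so the square roots leave exactly the weights
    \<open>1 - u\<close> and \<open>u\<close>.\<close>
  define w where "w = (\<lambda>i. of_real (sqrt (1 - u)) *\<^sub>C z i + of_real (sqrt u) *\<^sub>C y i)"
  have sq: "complex_of_real (sqrt (1 - u)) * of_real (sqrt (1 - u)) = of_real (1 - u)"
    "complex_of_real (sqrt u) * of_real (sqrt u) = of_real u"
    using u by (simp_all flip: of_real_mult)
  have w: "cinner (w i) (T (w l)) = of_real (1 - u) * cinner (z i) (T (z l)) + of_real u * cinner (y i) (T (y l))"
    if "clinear_op T" "cinner (z i) (T (y l)) = 0" "cinner (y i) (T (z l)) = 0" for T i l
    using that unfolding w_def clinear_op_def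
    by (simp add: cinner_simps sq flip: mult.assoc)
  have "orthonormal k w"
    using w[OF clinear_op_ident] yz z(1) y by (auto simp: orthonormal_def)
  moreover have "cinner (w i) (A j (w l)) = (if i = l then of_real (vec_nth ((1 - u) *\<^sub>R c + u *\<^sub>R b) j) else 0)"
    if "i < k" "l < k" for i l j
    using w[OF lin, of i j l] Ayz Az Ay that by simp
  ultimately show ?thesis unfolding mem_joint_rank_k_nr_iff[of A, OF lin] by blast
qed

text \<open>The same centre works: for fixed \<open>u\<close> the map from \<open>x\<close> to
  \<open>(1 - u) *\<^sub>R c + u *\<^sub>R x\<close> is continuous and sends \<open>S\<close> into
  \<open>S\<close>, hence closure into closure.\<close>

lemma starlike_closure:
  fixes S :: "'a::real_normed_vector set"
  assumes "starlike S"
  shows "starlike (closure S)"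
proof -
  obtain c where c: "c \<in> S" "\<And>x. x \<in> S \<Longrightarrow> closed_segment c x \<subseteq> S"
    using assms by (auto simp: starlike_def)
  have "(1 - u) *\<^sub>R c + u *\<^sub>R b \<in> closure S" if b: "b \<in> closure S" and u: "0 \<le> u" "u \<le> 1" for b u
  proof -
    have "(\<lambda>x. (1 - u) *\<^sub>R c + u *\<^sub>R x) ` S \<subseteq> closure S"
      using c u closure_subset[of S] by (fastforce simp: closed_segment_def)
    then have "(\<lambda>x. (1 - u) *\<^sub>R c + u *\<^sub>R x) ` closure S \<subseteq> closure S"
      by (intro image_closure_subset continuous_intros) auto
    with b show ?thesis by blast
  qed
  then show ?thesis
    using c(1) closure_subset[of S] by (auto simp: starlike_def closed_segment_def intro!: bexI[of _ c])
qed

theorem theorem3p4: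
  fixes A :: "'m::finite \<Rightarrow> 'h::chilbert_space \<Rightarrow> 'h" and k :: nat
  assumes "k > 0"
    and "\<And>j. bounded_op (A j) \<and> self_adjoint (A j)"
    and "dim_ge TYPE('h) (((CARD('m) + 2) * k - 1) * (CARD('m) + 1)^2)"
  shows "starlike (joint_rank_k_nr k A) \<and> starlike (closure (joint_rank_k_nr k A))"
proof -
  have lin: "\<And>j. clinear_op (A j)" and sa: "\<And>j. self_adjoint (A j)"
    using assms(2) by (auto simp: bounded_op_def)
  have "(CARD('m) + 2) * k > 1" using assms(1) by (cases k) auto
  from joint_rank_k_nr_nonempty[of A, OF lin sa this assms(3)]
  obtain c where c: "c \<in> joint_rank_k_nr ((CARD('m) + 2) * k) A" by blast
  \<comment> \<open>A star centre must itself lie in the set; the first \<open>k\<close> vectors of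
    a witness for the larger rank show this.\<close>
  have "c \<in> joint_rank_k_nr k A" by (rule joint_rank_k_nr_antimono[of A, OF lin _ c]) simp
  moreover have "closed_segment c b \<subseteq> joint_rank_k_nr k A" if "b \<in> joint_rank_k_nr k A" for b
    using joint_rank_k_nr_segment[of A, OF lin sa c that] by (auto simp: closed_segment_def)
  ultimately have "starlike (joint_rank_k_nr k A)" unfolding starlike_def by blast
  then show ?thesis by (simp add: starlike_closure)
qed

end
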